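(* Let $\lambda\geq 2$ and $\mu>0$ be cardinals and let $\alpha>0$ be an ordinal. The tree $\dot{\bigcup}_{\mu}\,{}^{<\alpha}\lambda$ is reversible if and only if $\min\{\alpha,\lambda\mu\}<\omega$.
   Context: ${}^{<\alpha}\lambda=\bigcup_{\beta<\alpha}{}^{\beta}\lambda$ is the tree of all sequences in $\lambda$ of length $<\alpha$, ordered by proper extension. $\dot{\bigcup}_{\mu}\,T$ denotes the disjoint union of $\mu$-many disjoint copies of the tree $T$ (elements of different copies are incomparable). $\lambda\mu$ is the cardinal product. A tree $T$ (as a strict partial order) is reversible iff every condensation of $T$, i.e. every bijection $f:T\to T$ such that $x<y$ implies $f(x)<f(y)$, is an automorphism of $T$. *)

theory Defs
  imports Main
begin

unbundle cardinal_syntax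

text \<open>
  Ordinals are well-orders and cardinals are \<^const>\<open>Card_order\<close>s, all in the sense of the
  library (reflexive relations, compared by \<open><o\<close>, \<open>\<le>o\<close> and \<open>=o\<close>); \<open>\<omega>\<close> is \<^const>\<open>natLeq\<close>.
\<close>

text \<open>
  The minimum of two ordinals represented on different types has to live on a common type, hence
  the copies along the injections into the sum type.
\<close>

definition ord_min :: "'a rel \<Rightarrow> 'b rel \<Rightarrow> ('a + 'b) rel" where
  "ord_min r s = (if r \<le>o s then dir_image r Inl else dir_image s Inr)"

text \<open>A structure is given by a carrier \<open>A\<close> and a strict relation \<open>lt\<close>, relevant only on \<open>A\<close>.\<close>

definition condensation :: "'t set \<Rightarrow> ('t \<Rightarrow> 't \<Rightarrow> bool) \<Rightarrow> ('t \<Rightarrow> 't) \<Rightarrow> bool" where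
  "condensation A lt f \<longleftrightarrow> bij_betw f A A \<and> monotone_on A lt lt f"

definition automorphism :: "'t set \<Rightarrow> ('t \<Rightarrow> 't \<Rightarrow> bool) \<Rightarrow> ('t \<Rightarrow> 't) \<Rightarrow> bool" where
  "automorphism A lt f \<longleftrightarrow> bij_betw f A A \<and> (\<forall>x\<in>A. \<forall>y\<in>A. lt x y \<longleftrightarrow> lt (f x) (f y))"

definition reversible :: "'t set \<Rightarrow> ('t \<Rightarrow> 't \<Rightarrow> bool) \<Rightarrow> bool" where
  "reversible A lt \<longleftrightarrow> (\<forall>f. condensation A lt f \<longrightarrow> automorphism A lt f)"

definition sequences :: "'i set \<Rightarrow> 'v set \<Rightarrow> ('i \<rightharpoonup> 'v) set" where
  "sequences I V = {s. dom s = I \<and> ran s \<subseteq> V}"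

text \<open>
  An element \<open>b\<close> of the field of \<open>\<alpha>\<close> stands for the ordinal \<open>\<beta> < \<alpha>\<close> that is the order type of
  \<^term>\<open>underS \<alpha> b\<close>, the set of its strict predecessors; every \<open>\<beta> < \<alpha>\<close> arises from exactly one
  such \<open>b\<close>.  The set \<^term>\<open>underS \<alpha> b\<close> is the index set of the sequences of length \<open>\<beta>\<close>.
\<close>

definition seq_tree :: "'a rel \<Rightarrow> 'l rel \<Rightarrow> ('a \<rightharpoonup> 'l) set" where
  "seq_tree \<alpha> \<kappa> = (\<Union>b\<in>Field \<alpha>. sequences (underS \<alpha> b) (Field \<kappa>))"

definition proper_ext :: "('a \<rightharpoonup> 'l) \<Rightarrow> ('a \<rightharpoonup> 'l) \<Rightarrow> bool" where
  "proper_ext s t \<longleftrightarrow> s \<subseteq>\<^sub>m t \<and> s \<noteq> t"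

definition copies :: "'m rel \<Rightarrow> 't set \<Rightarrow> ('m \<times> 't) set" where
  "copies \<mu> A = Field \<mu> \<times> A"

definition copies_less :: "('t \<Rightarrow> 't \<Rightarrow> bool) \<Rightarrow> 'm \<times> 't \<Rightarrow> 'm \<times> 't \<Rightarrow> bool" where
  "copies_less lt p q \<longleftrightarrow> fst p = fst q \<and> lt (snd p) (snd q)"

end

theory Submission
  imports Defs
begin

text \<open>
  Both directions rest on what a condensation \<open>f\<close> can do to the levels of a tree, where the level of a
  sequence is its length.  It never lowers a level, and if it preserves all levels it is an
  automorphism, because a node has just one predecessor on each lower level.  So the question is
  whether a condensation can push nodes up.

  If \<open>\<alpha>\<close> is finite, it cannot: every node lies at the bottom of a chain reaching through all the
  higher levels, and the images of that chain have no room left if its bottom is raised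
  (\<open>reversible_if_finite_height\<close>).  If \<open>\<kappa>\<close> and \<open>\<mu>\<close> are finite, it cannot either, by induction on the
  level: once the lower levels are preserved, surjectivity forces the members of each set of siblings
  (all roots, or all children of a node) to come from one set of siblings, and two finite sets of equal
  size leave no surplus element that could be pushed up (\<open>reversible_if_finite_siblings\<close>).  At limit
  levels a node is determined by its predecessors, so the branching there is trivial, however large the
  level is.

  If \<open>\<alpha>\<close> is infinite and \<open>\<kappa>\<close> or \<open>\<mu>\<close> is infinite, Hilbert's hotel applies.  If \<open>n\<close> is
  finite, then \<open>n + \<beta> < \<alpha>\<close> if and only if \<open>\<beta> < \<alpha>\<close>, so the part of the tree above any node of finite
  length is a copy of the whole tree.  One finds a family of such disjoint parts,
  indexed by the integers, such that moving each part to the place of the next one preserves the order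
  and at one step puts a part on top of a node that was not below it before
  (\<open>not_reversible_if_cones_shift\<close>).  An infinite \<open>\<mu>\<close> provides a row of separate trees for the negative
  indices, an infinite \<open>\<kappa>\<close> a row of siblings.
\<close>

section \<open>Condensations of levelled trees\<close>

lemma underS_linear:
  assumes "Well_order r" "a \<in> Field r" "b \<in> Field r"
  shows "a \<in> underS r b \<or> a = b \<or> b \<in> underS r a"
  using assms unfolding underS_def order_on_defs total_on_def by auto

text \<open>
  Trees enter the positive half only through the levels of their nodes: the axioms say that the
  predecessors of a node form a chain with exactly one node on every lower level.  The levels are
  elements of a well-order \<open>r\<close>, and ``below level \<open>b\<close>'' is \<^term>\<open>underS r b\<close>.
\<close>

locale levelled_tree =
  fixes A :: "'t set" and lt :: "'t \<Rightarrow> 't \<Rightarrow> bool" and r :: "'a rel" and lev :: "'t \<Rightarrow> 'a"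
  assumes well_order: "Well_order r"
    and lev_Field: "x \<in> A \<Longrightarrow> lev x \<in> Field r"
    and lev_less: "x \<in> A \<Longrightarrow> y \<in> A \<Longrightarrow> lt x y \<Longrightarrow> lev x \<in> underS r (lev y)"
    and ancestor_exists: "y \<in> A \<Longrightarrow> b \<in> underS r (lev y) \<Longrightarrow> \<exists>x\<in>A. lt x y \<and> lev x = b"
    and ancestor_unique: "x \<in> A \<Longrightarrow> x' \<in> A \<Longrightarrow> y \<in> A \<Longrightarrow> lt x y \<Longrightarrow> lt x' y
      \<Longrightarrow> lev x = lev x' \<Longrightarrow> x = x'"
    and lt_trans: "lt x y \<Longrightarrow> lt y z \<Longrightarrow> lt x z"
begin

lemma underS_asym: "a \<in> underS r b \<Longrightarrow> b \<notin> underS r a"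
  using well_order unfolding underS_def order_on_defs by (auto dest: antisymD)

lemma underS_wf: "wf {(a, b). a \<in> underS r b}"
proof -
  have "{(a, b). a \<in> underS r b} = r - Id" by (auto simp: underS_def)
  then show ?thesis using well_order unfolding well_order_on_def by simp
qed

context
  fixes f
  assumes condensation: "condensation A lt f"
begin

lemma f_in: "x \<in> A \<Longrightarrow> f x \<in> A"
  using condensation unfolding condensation_def bij_betw_def by auto

lemma f_eq: "x \<in> A \<Longrightarrow> y \<in> A \<Longrightarrow> f x = f y \<Longrightarrow> x = y"
  using condensation unfolding condensation_def bij_betw_def by (auto dest: inj_onD)

lemma f_surj: "y \<in> A \<Longrightarrow> \<exists>x\<in>A. y = f x"
  using condensation unfolding condensation_def bij_betw_def by auto

lemma f_less: "x \<in> A \<Longrightarrow> y \<in> A \<Longrightarrow> lt x y \<Longrightarrow> lt (f x) (f y)"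
  using condensation unfolding condensation_def monotone_on_def by auto

text \<open>
  The usual fact that a strictly increasing map between well-founded orders cannot lower ranks.  For
  a node \<open>x\<close> of minimal level that drops, its predecessor on level \<open>lev (f x)\<close> has to drop as well.
\<close>

lemma condensation_lev_not_decreasing:
  "x \<in> A \<Longrightarrow> lev (f x) \<notin> underS r (lev x)"
proof (induction "lev x" arbitrary: x rule: wf_induct_rule[OF underS_wf])
  case (1 x)
  show ?case
  proof
    assume lower: "lev (f x) \<in> underS r (lev x)"
    then obtain y where y: "y \<in> A" "lt y x" "lev y = lev (f x)"
      using ancestor_exists 1(2) by blast
    then have "lev (f y) \<in> underS r (lev y)"
      using lev_less[OF f_in f_in f_less] 1(2) by simp
    moreover have "lev (f y) \<notin> underS r (lev y)"
      using 1(1)[of y] y lower by simp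
    ultimately show False by blast
  qed
qed

text \<open>
  If \<open>f x\<close> lies below \<open>f y\<close>, then \<open>y\<close> has a predecessor \<open>x'\<close> on the level of \<open>x\<close>, and \<open>f x'\<close> and
  \<open>f x\<close> are predecessors of \<open>f y\<close> on one level, hence equal.  So reversibility is reduced to showing
  that no condensation raises the level of a node.
\<close>

lemma automorphism_if_lev_preserved:
  assumes lev_f: "\<And>x. x \<in> A \<Longrightarrow> lev (f x) = lev x"
  shows "automorphism A lt f"
  unfolding automorphism_def
proof (intro conjI ballI iffI)
  show "bij_betw f A A" using condensation unfolding condensation_def by blast
next
  fix x y assume "x \<in> A" "y \<in> A" "lt x y"
  then show "lt (f x) (f y)" by (rule f_less)
next
  fix x y assume A: "x \<in> A" "y \<in> A" and less: "lt (f x) (f y)"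
  have "lev x \<in> underS r (lev y)"
    using lev_less[OF f_in f_in less] A lev_f by simp
  then obtain x' where x': "x' \<in> A" "lt x' y" "lev x' = lev x"
    using ancestor_exists A by blast
  then have "f x' = f x"
    using ancestor_unique[of "f x'" "f x" "f y"] A less f_in f_less lev_f by simp
  then show "lt x y" using f_eq A x' by blast
qed

end

text \<open>
  Among the nodes that \<open>f\<close> raises, take \<open>x\<close> on the highest possible level; say \<open>f x\<close> is on level
  \<open>b\<close>.  Being pruned, the tree has a node \<open>y\<close> above \<open>x\<close> on level \<open>b\<close>.  By the choice of \<open>x\<close> the level
  of \<open>y\<close> is preserved, yet \<open>f y\<close> lies above \<open>f x\<close> and so beyond level \<open>b\<close>.
\<close>

lemma reversible_if_finite_height:
  assumes finite: "finite (Field r)"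
    and pruned: "\<And>x b. x \<in> A \<Longrightarrow> b \<in> Field r \<Longrightarrow> lev x \<in> underS r b \<Longrightarrow> \<exists>y\<in>A. lt x y \<and> lev y = b"
  shows "reversible A lt"
  unfolding reversible_def
proof (intro allI impI)
  fix f assume c: "condensation A lt f"
  have "wf ({(a, b). a \<in> underS r b}\<inverse>)"
  proof (rule finite_acyclic_wf_converse)
    have "{(a, b). a \<in> underS r b} \<subseteq> Field r \<times> Field r"
      by (auto simp: underS_def Field_def)
    then show "finite {(a, b). a \<in> underS r b}"
      using finite by (auto intro: finite_subset)
    show "acyclic {(a, b). a \<in> underS r b}" using underS_wf by (rule wf_acyclic)
  qed
  then have "lev (f x) = lev x" if "x \<in> A" for x
    using that
  \<comment> \<open>Well-founded induction downwards, available because there are finitely many levels.\<close>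
  proof (induction "lev x" arbitrary: x rule: wf_induct_rule)
    case (less x)
    show ?case
    proof (rule ccontr)
      assume "lev (f x) \<noteq> lev x"
      then have up: "lev x \<in> underS r (lev (f x))"
        using underS_linear[OF well_order] condensation_lev_not_decreasing[OF c less(2)] lev_Field f_in[OF c] less(2)
        by metis
      then obtain y where y: "y \<in> A" "lt x y" "lev y = lev (f x)"
        using pruned less(2) lev_Field f_in[OF c] by blast
      then have "lev (f y) = lev y" using less(1) up by simp
      moreover have "lev (f x) \<in> underS r (lev (f y))"
        using lev_less f_in[OF c] f_less[OF c] less(2) y by blast
      ultimately show False using y underS_asym by metis
    qed
  qed
  then show "automorphism A lt f" using automorphism_if_lev_preserved[OF c] by blast
qed

text \<open>
  One notion for three situations: the siblings of a root are all roots, those of a node on a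
  successor level are the children of its parent, and on a limit level of a tree of sequences a node
  is its own only sibling.
\<close>

definition siblings :: "'t \<Rightarrow> 't set" where
  "siblings x = {y \<in> A. lev y = lev x \<and> (\<forall>z\<in>A. lt z y \<longleftrightarrow> lt z x)}"

text \<open>
  Suppose that levels below that of \<open>x\<close> are preserved and that \<open>f\<close> raises \<open>x\<close>.  Let \<open>y\<close> be the
  predecessor of \<open>f x\<close> on the level of \<open>x\<close>.  Every sibling of \<open>y\<close> has its preimage among the siblings
  of \<open>x\<close>; since both sibling sets are finite of the same size, these preimages exhaust the siblings of
  \<open>x\<close>.  So \<open>f x\<close> is a sibling of \<open>y\<close> and lies on the level of \<open>x\<close> after all.
\<close>

lemma reversible_if_finite_siblings:
  assumes finite: "\<And>x. x \<in> A \<Longrightarrow> finite (siblings x)"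
    and card: "\<And>x y. x \<in> A \<Longrightarrow> y \<in> A \<Longrightarrow> lev x = lev y \<Longrightarrow> card (siblings x) = card (siblings y)"
  shows "reversible A lt"
  unfolding reversible_def
proof (intro allI impI)
  fix f assume c: "condensation A lt f"
  note f_in = f_in[OF c] and f_less = f_less[OF c] and f_eq = f_eq[OF c]
  have "lev (f x) = lev x" if "x \<in> A" for x
    using that
  proof (induction "lev x" arbitrary: x rule: wf_induct_rule[OF underS_wf])
    case (1 x)
    then have IH: "\<And>z. z \<in> A \<Longrightarrow> lev z \<in> underS r (lev x) \<Longrightarrow> lev (f z) = lev z" by simp
    have x: "x \<in> A" by fact
    show ?case
    proof (rule ccontr)
      assume "lev (f x) \<noteq> lev x"
      then have up: "lev x \<in> underS r (lev (f x))"
        using underS_linear[OF well_order] condensation_lev_not_decreasing[OF c x] lev_Field f_in x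
        by metis
      then obtain y where y: "y \<in> A" "lt y (f x)" "lev y = lev x"
        using ancestor_exists f_in x by metis
      have preimage_sibling: "u \<in> siblings x" if u: "u \<in> A" "f u \<in> siblings y" for u
      proof -
        have fu: "lev (f u) = lev x" "\<And>z. z \<in> A \<Longrightarrow> lt z (f u) \<Longrightarrow> lt z y"
          using u(2) y(3) unfolding siblings_def by auto
        \<comment> \<open>If \<open>u\<close> were on a lower level, so would be \<open>f u\<close>, by the induction hypothesis.\<close>
        have lev_u: "lev u = lev x"
          using underS_linear[OF well_order, of "lev u" "lev x"] lev_Field u(1) x IH[of u]
            condensation_lev_not_decreasing[OF c u(1)] fu(1) by metis
        have below: "lt z x" if z: "z \<in> A" "lt z u" for z
        proof -
          have lev_z: "lev z \<in> underS r (lev x)" using lev_less z u lev_u by metis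
          then obtain z' where z': "z' \<in> A" "lt z' x" "lev z' = lev z"
            using ancestor_exists x by blast
          have fz: "lev (f z) = lev z" "lev (f z') = lev z"
            using IH lev_z z z' by auto
          have "lt (f z) (f x)" using lt_trans[OF fu(2)] f_in f_less z u y by blast
          moreover have "lt (f z') (f x)" using f_less z' x by blast
          ultimately have "f z = f z'"
            using ancestor_unique[of "f z" "f z'" "f x"] f_in z(1) z'(1) x fz by simp
          then show ?thesis using f_eq z z' by blast
        qed
        have "lt z u" if z: "z \<in> A" "lt z x" for z
        proof -
          have "lev z \<in> underS r (lev u)" using lev_less z x lev_u by metis
          then obtain z' where z': "z' \<in> A" "lt z' u" "lev z' = lev z"
            using ancestor_exists u by blast
          then show ?thesis using ancestor_unique[of z' z x] below z x by metis
        qed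
        then show ?thesis using below lev_u u unfolding siblings_def by auto
      qed
      have "siblings y \<subseteq> f ` siblings x"
      proof
        fix w assume w: "w \<in> siblings y"
        then have "w \<in> A" unfolding siblings_def by simp
        then show "w \<in> f ` siblings x"
          using f_surj[OF c] preimage_sibling w by (metis image_eqI)
      qed
      moreover have "inj_on f (siblings x)"
        using f_eq unfolding inj_on_def siblings_def by simp
      then have "card (siblings y) = card (f ` siblings x)"
        using card[OF y(1) x y(3)] by (simp add: card_image)
      ultimately have "siblings y = f ` siblings x"
        using finite[OF x] by (simp add: card_subset_eq)
      moreover have "x \<in> siblings x" using x unfolding siblings_def by simp
      ultimately have "f x \<in> siblings y" by blast
      then show False using y up unfolding siblings_def underS_def by simp
    qed
  qed
  then show "automorphism A lt f" using automorphism_if_lev_preserved[OF c] by blast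
qed

end

section \<open>Shifting a two-sided sequence of cones\<close>

text \<open>
  The source of all non-reversibility.  The cones \<open>h z ` S\<close> for \<open>z :: int\<close> are disjoint, closed upwards
  and copies of each other.  Moving each cone onto the next one and fixing everything else is a
  bijection, because the index set has neither a first nor a last element.  It preserves the order as
  soon as a node below some cone, outside of all of them, is also below the next cone; it is not an
  automorphism if on some step a new node \<open>x\<close> gets below the cone.
\<close>

lemma not_reversible_if_cones_shift:
  fixes h :: "int \<Rightarrow> 's \<Rightarrow> 't"
  assumes h_in: "\<And>z s. s \<in> S \<Longrightarrow> h z s \<in> A"
    and h_eq: "\<And>z z' s s'. s \<in> S \<Longrightarrow> s' \<in> S \<Longrightarrow> h z s = h z' s' \<Longrightarrow> z = z' \<and> s = s'"
    and up: "\<And>z s y. s \<in> S \<Longrightarrow> y \<in> A \<Longrightarrow> lt (h z s) y \<Longrightarrow> y \<in> h z ` S"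
    and iso: "\<And>z s s'. s \<in> S \<Longrightarrow> s' \<in> S \<Longrightarrow> lt (h z s) (h z s') \<Longrightarrow> lt (h (z + 1) s) (h (z + 1) s')"
    and below: "\<And>x z s. x \<in> A \<Longrightarrow> s \<in> S \<Longrightarrow> x \<notin> (\<Union>z. h z ` S) \<Longrightarrow> lt x (h z s) \<Longrightarrow> lt x (h (z + 1) s)"
    and witness: "x \<in> A" "x \<notin> (\<Union>z. h z ` S)" "s \<in> S" "\<not> lt x (h z s)" "lt x (h (z + 1) s)"
  shows "\<not> reversible A lt"
proof
  assume "reversible A lt"
  define H where "H = (\<lambda>(z, s). h z s)"
  define C where "C = (\<Union>z. h z ` S)"
  define f where
    "f x = (if x \<in> C then case inv_into (UNIV \<times> S) H x of (z, s) \<Rightarrow> h (z + 1) s else x)" for x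
  have "inj_on H (UNIV \<times> S)" using h_eq unfolding inj_on_def H_def by auto
  then have "inv_into (UNIV \<times> S) H (H (z, s)) = (z, s)" if "s \<in> S" for z s
    using that by (intro inv_into_f_f) auto
  then have f_h: "f (h z s) = h (z + 1) s" if "s \<in> S" for z s
    using that unfolding f_def C_def H_def by auto
  have f_out: "f x = x" if "x \<notin> C" for x using that unfolding f_def by simp
  have f_C: "f x \<in> C" if "x \<in> C" for x using that f_h unfolding C_def by auto
  have C_A: "C \<subseteq> A" using h_in unfolding C_def by auto
  have "inj_on f A"
  proof (rule inj_onI)
    fix x y assume "x \<in> A" "y \<in> A" and eq: "f x = f y"
    then have "x \<in> C \<longleftrightarrow> y \<in> C" using f_C f_out by metis
    moreover have "x = y" if "x \<in> C" "y \<in> C"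
    proof -
      from that obtain z s z' s' where "x = h z s" "s \<in> S" "y = h z' s'" "s' \<in> S"
        unfolding C_def by auto
      then show ?thesis using eq h_eq[of s s' "z + 1" "z' + 1"] by (simp add: f_h)
    qed
    ultimately show "x = y" using eq f_out by metis
  qed
  moreover have "f ` A = A"
  proof (intro equalityI subsetI)
    fix y assume "y \<in> f ` A"
    then obtain x where x: "x \<in> A" "y = f x" by blast
    then show "y \<in> A" using f_C[of x] f_out[of x] C_A by (cases "x \<in> C") auto
  next
    fix y assume y: "y \<in> A"
    show "y \<in> f ` A"
    proof (cases "y \<in> C")
      case True
      then obtain z s where "y = h z s" "s \<in> S" unfolding C_def by auto
      then have "y = f (h (z - 1) s)" "h (z - 1) s \<in> A" using f_h h_in by simp_all
      then show ?thesis by blast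
    next
      case False
      then show ?thesis using f_out y by force
    qed
  qed
  moreover have "lt (f x) (f y)" if xy: "x \<in> A" "y \<in> A" "lt x y" for x y
  proof (cases "x \<in> C")
    case True
    then obtain z s where x: "x = h z s" "s \<in> S" unfolding C_def by auto
    then obtain s' where "y = h z s'" "s' \<in> S" using up xy by blast
    then show ?thesis using x xy iso by (simp add: f_h)
  next
    case False
    then show ?thesis
      using below xy f_h f_out unfolding C_def by (cases "y \<in> C") (auto simp: C_def)
  qed
  ultimately have "condensation A lt f"
    unfolding condensation_def bij_betw_def monotone_on_def by blast
  then have "automorphism A lt f" using \<open>reversible A lt\<close> unfolding reversible_def by blast
  then have "lt x (h z s) \<longleftrightarrow> lt (f x) (f (h z s))"
    using witness h_in unfolding automorphism_def by blast
  then show False using witness f_h f_out unfolding C_def by simp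
qed

section \<open>Cones in a tree of sequences of infinite height\<close>

text \<open>
  An infinite well-order begins with a copy \<open>e 0, e 1, \<dots>\<close> of \<open>\<omega>\<close>.  Prepending one entry to a
  sequence moves its entries at finite positions one step to the right and leaves those at infinite
  positions in place, because \<open>1 + \<beta> = \<beta>\<close> for infinite \<open>\<beta>\<close>.  This is why cones of the tree are
  copies of the whole tree.
\<close>

locale omega_embedding =
  fixes r :: "'a rel" and e :: "nat \<Rightarrow> 'a"
  assumes well_order: "Well_order r"
    and e_Field: "e n \<in> Field r"
    and inj_e: "inj e"
    and underS_e: "underS r (e n) = e ` {..<n}"
begin

lemma range_e_underS: "b \<in> Field r \<Longrightarrow> b \<notin> range e \<Longrightarrow> e n \<in> underS r b"
proof -
  assume b: "b \<in> Field r" "b \<notin> range e"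
  have "b \<notin> underS r (e n)" using b underS_e by auto
  then show ?thesis
    using b underS_linear[OF well_order e_Field b(1)] by blast
qed

definition push :: "'a \<Rightarrow> 'a" where
  "push a = (if a \<in> range e then e (Suc (inv e a)) else a)"

definition pull :: "'a \<Rightarrow> 'a" where
  "pull a = (if a \<in> range e then e (inv e a - 1) else a)"

lemma push_e [simp]: "push (e n) = e (Suc n)"
  using inj_e by (simp add: push_def)

lemma pull_e [simp]: "pull (e n) = e (n - 1)"
  using inj_e by (simp add: pull_def)

lemma e_eq [simp]: "e m = e n \<longleftrightarrow> m = n"
  using inj_e by (auto dest: injD)

lemma push_out: "a \<notin> range e \<Longrightarrow> push a = a" by (simp add: push_def)

lemma pull_out: "a \<notin> range e \<Longrightarrow> pull a = a" by (simp add: pull_def)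

lemma pull_push [simp]: "pull (push a) = a"
  by (cases "a \<in> range e") (auto simp: push_out pull_out)

lemma push_pull: "a \<noteq> e 0 \<Longrightarrow> push (pull a) = a"
  by (cases "a \<in> range e") (auto simp: push_out pull_out gr0_conv_Suc)

lemma push_neq [simp]: "push a \<noteq> e 0"
  by (cases "a \<in> range e") (auto simp: push_out)

lemma push_Field: "b \<in> Field r \<Longrightarrow> push b \<in> Field r"
  by (cases "b \<in> range e") (auto simp: push_out e_Field)

lemma pull_Field: "b \<in> Field r \<Longrightarrow> pull b \<in> Field r"
  by (cases "b \<in> range e") (auto simp: pull_out e_Field)

text \<open>
  The equation \<open>1 + \<beta> = \<beta> + 1\<close> for finite and \<open>1 + \<beta> = \<beta>\<close> for infinite \<open>\<beta>\<close>, as a statement on index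
  sets: adding \<open>e 0\<close> in front of the domain of a sequence of length \<open>b\<close> yields length \<open>push b\<close>.
\<close>

lemma underS_push:
  assumes "b \<in> Field r"
  shows "a \<in> underS r (push b) \<longleftrightarrow> a = e 0 \<or> pull a \<in> underS r b"
proof (cases "b \<in> range e")
  case True
  then obtain n where b: "b = e n" by blast
  show ?thesis
  proof (cases "a \<in> range e")
    case True
    then obtain m where "a = e m" by blast
    then show ?thesis unfolding b by (cases m) (auto simp: underS_e)
  qed (auto simp: b underS_e pull_out)
next
  case False
  then show ?thesis
    using range_e_underS[OF assms False]
    by (cases "a \<in> range e") (auto simp: push_out pull_out)
qed

definition cons :: "'l \<Rightarrow> ('a \<rightharpoonup> 'l) \<Rightarrow> ('a \<rightharpoonup> 'l)" where
  "cons v s = (\<lambda>a. if a = e 0 then Some v else s (pull a))"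

lemma cons_push [simp]: "cons v s (push a) = s a"
  by (simp add: cons_def)

lemma cons_0 [simp]: "cons v s (e 0) = Some v"
  by (simp add: cons_def)

lemma cons_Suc [simp]: "cons v s (e (Suc n)) = s (e n)"
  by (simp add: cons_def)

lemma cons_uncons: "t (e 0) = Some v \<Longrightarrow> cons v (t \<circ> push) = t"
  by (auto simp: cons_def push_pull)

lemma cons_map_le [simp]: "cons v s \<subseteq>\<^sub>m cons v t \<longleftrightarrow> s \<subseteq>\<^sub>m t"
proof
  assume "cons v s \<subseteq>\<^sub>m cons v t"
  then show "s \<subseteq>\<^sub>m t" unfolding map_le_def by (metis cons_push domIff)
qed (auto simp: map_le_def cons_def dom_def)

lemma cons_eq [simp]: "cons v s = cons v t \<longleftrightarrow> s = t"
  by (metis cons_push ext)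

lemma ran_cons: "ran (cons v s) = insert v (ran s)"
proof (intro equalityI subsetI)
  fix w assume "w \<in> insert v (ran s)"
  then show "w \<in> ran (cons v s)"
    unfolding ran_def by (auto intro: exI[of _ "e 0"]) (metis cons_push)
qed (auto simp: ran_def cons_def split: if_splits)

lemma cons_in_seq_tree:
  "v \<in> Field \<kappa> \<Longrightarrow> s \<in> seq_tree r \<kappa> \<Longrightarrow> cons v s \<in> seq_tree r \<kappa>"
proof -
  assume v: "v \<in> Field \<kappa>" and "s \<in> seq_tree r \<kappa>"
  then obtain b where b: "b \<in> Field r" "dom s = underS r b" "ran s \<subseteq> Field \<kappa>"
    unfolding seq_tree_def sequences_def by auto
  then have "dom (cons v s) = underS r (push b)"
    using underS_push[OF b(1)] by (auto simp: cons_def dom_def split: if_splits)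
  then show ?thesis
    using b v push_Field unfolding seq_tree_def sequences_def by (auto simp: ran_cons)
qed

lemma uncons_in_seq_tree:
  assumes "t \<in> seq_tree r \<kappa>" "t (e 0) = Some v"
  shows "t \<circ> push \<in> seq_tree r \<kappa>"
proof -
  obtain b where b: "b \<in> Field r" "dom t = underS r b" "ran t \<subseteq> Field \<kappa>"
    using assms unfolding seq_tree_def sequences_def by auto
  have "e 0 \<in> underS r b" using assms b by auto
  then have "b \<noteq> e 0" by (auto simp: underS_def)
  then have "dom t = underS r (push (pull b))" using b push_pull by simp
  then have "a \<in> dom (t \<circ> push) \<longleftrightarrow> a \<in> underS r (pull b)" for a
    using underS_push[OF pull_Field[OF b(1)], of "push a"]
    by (metis comp_apply domIff pull_push push_neq)
  then have "dom (t \<circ> push) = underS r (pull b)" by blast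
  moreover have "ran (t \<circ> push) \<subseteq> ran t" unfolding ran_def by auto
  ultimately have "t \<circ> push \<in> sequences (underS r (pull b)) (Field \<kappa>)"
    using b(3) unfolding sequences_def by simp
  then show ?thesis using pull_Field[OF b(1)] unfolding seq_tree_def by (rule UN_I[rotated])
qed

text \<open>
  Concatenation of a finite list with a sequence of arbitrary length.  The image of the tree under
  \<open>graft vs\<close> is the cone above the node \<open>graft vs Map.empty\<close>.
\<close>

definition graft :: "'l list \<Rightarrow> ('a \<rightharpoonup> 'l) \<Rightarrow> ('a \<rightharpoonup> 'l)" where
  "graft vs s = foldr cons vs s"

lemma graft_simps [simp]: "graft [] s = s" "graft (v # vs) s = cons v (graft vs s)"
  by (simp_all add: graft_def)

lemma empty_in_seq_tree: "Map.empty \<in> seq_tree r \<kappa>"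
proof -
  have "dom Map.empty = underS r (e 0)" by (simp add: underS_e)
  then show ?thesis using e_Field unfolding seq_tree_def sequences_def by (auto intro: bexI[of _ "e 0"])
qed

lemma graft_in_seq_tree:
  "set vs \<subseteq> Field \<kappa> \<Longrightarrow> s \<in> seq_tree r \<kappa> \<Longrightarrow> graft vs s \<in> seq_tree r \<kappa>"
  by (induction vs) (auto intro: cons_in_seq_tree)

lemma graft_eq [simp]: "graft vs s = graft vs t \<longleftrightarrow> s = t"
  by (induction vs) auto

lemma graft_map_le [simp]: "graft vs s \<subseteq>\<^sub>m graft vs t \<longleftrightarrow> s \<subseteq>\<^sub>m t"
  by (induction vs) auto

lemma graft_nth: "n < length vs \<Longrightarrow> graft vs s (e n) = Some (vs ! n)"
proof (induction vs arbitrary: n)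
  case (Cons v vs)
  then show ?case by (cases n) auto
qed simp

lemma above_graft:
  assumes "t \<in> seq_tree r \<kappa>" "graft vs s \<subseteq>\<^sub>m t"
  shows "t \<in> graft vs ` seq_tree r \<kappa>"
  using assms
proof (induction vs arbitrary: t)
  case (Cons v vs)
  then have v: "t (e 0) = Some v" unfolding map_le_def by (auto dest: bspec[of _ _ "e 0"] simp: domIff)
  have "cons v (graft vs s) \<subseteq>\<^sub>m cons v (t \<circ> push)" using Cons.prems cons_uncons[of t, OF v] by simp
  then have "t \<circ> push \<in> graft vs ` seq_tree r \<kappa>"
    using Cons.IH uncons_in_seq_tree[OF Cons.prems(1) v] by simp
  then obtain s' where s': "s' \<in> seq_tree r \<kappa>" "t \<circ> push = graft vs s'" by blast
  then have "t = graft (v # vs) s'" using cons_uncons[of t, OF v] by simp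
  then show ?case using s'(1) by (rule image_eqI)
qed auto

text \<open>
  A node comparable from below with a node of a cone lies in the cone itself or on the finite stem
  leading to its apex.
\<close>

lemma below_graft:
  assumes "x \<in> seq_tree r \<kappa>" "x \<subseteq>\<^sub>m graft vs s"
  shows "x \<in> graft vs ` seq_tree r \<kappa> \<or> (\<exists>n<length vs. x = graft (take n vs) Map.empty)"
  using assms
proof (induction vs arbitrary: x)
  case (Cons v vs)
  show ?case
  proof (cases "e 0 \<in> dom x")
    case True
    then have v: "x (e 0) = Some v" using Cons.prems(2) unfolding map_le_def by simp
    have "cons v (x \<circ> push) \<subseteq>\<^sub>m cons v (graft vs s)" using Cons.prems cons_uncons[of x, OF v] by simp
    then have "x \<circ> push \<subseteq>\<^sub>m graft vs s" by simp
    note Cons.IH[OF uncons_in_seq_tree[OF Cons.prems(1) v] this]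
    then consider "x \<circ> push \<in> graft vs ` seq_tree r \<kappa>"
      | n where "n < length vs" "x \<circ> push = graft (take n vs) Map.empty"
      by blast
    then show ?thesis
    proof cases
      case 1
      then obtain s' where s': "s' \<in> seq_tree r \<kappa>" "x \<circ> push = graft vs s'" by blast
      then have "x = graft (v # vs) s'" using cons_uncons[of x, OF v] by simp
      then show ?thesis using s'(1) by (intro disjI1 image_eqI)
    next
      case 2
      then have "x = graft (take (Suc n) (v # vs)) Map.empty" using cons_uncons[of x, OF v] by simp
      then show ?thesis using 2 by (metis Suc_less_eq length_Cons)
    qed
  next
    case False
    obtain b where b: "b \<in> Field r" "dom x = underS r b"
      using Cons.prems unfolding seq_tree_def sequences_def by auto
    then have "b \<in> range e" using False range_e_underS by blast
    then have "dom x = {}" using False b underS_e by auto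
    then show ?thesis by (intro disjI2 exI[of _ 0]) simp
  qed
qed auto

lemma graft_take_less:
  "n < length vs \<Longrightarrow> proper_ext (graft (take n vs) Map.empty) (graft vs s)"
proof (induction vs arbitrary: n)
  case (Cons v vs)
  show ?case
  proof (cases n)
    case 0
    have "cons v (graft vs s) \<noteq> Map.empty" by (metis cons_0 option.distinct(1))
    then show ?thesis using 0 unfolding proper_ext_def by auto
  next
    case (Suc m)
    then show ?thesis using Cons unfolding proper_ext_def by auto
  qed
qed simp

lemma graft_empty_nth: "length vs \<le> n \<Longrightarrow> graft vs Map.empty (e n) = None"
proof (induction vs arbitrary: n)
  case (Cons v vs)
  then show ?case by (cases n) auto
qed simp

text \<open>
  The shift of cones in a forest of sequences: the cone number \<open>z\<close> lies in the copy \<open>c z\<close> above the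
  list \<open>w z\<close>.  Incomparable addresses give disjoint cones.  The stem of each cone has to be a part of
  the stem of the next one, and the shift from \<open>i\<close> to \<open>i + 1\<close> puts a cone on top of a new stem node
  \<open>take k (w (i + 1))\<close> which belongs to none of the cones.
\<close>

lemma not_reversible_if_addresses_shift:
  fixes c :: "int \<Rightarrow> 'm" and w :: "int \<Rightarrow> 'l list"
  assumes c: "\<And>z. c z \<in> Field \<mu>" and w: "\<And>z. set (w z) \<subseteq> Field \<kappa>"
    and incomparable: "\<And>z z'. z \<noteq> z' \<Longrightarrow>
      c z \<noteq> c z' \<or> (\<exists>n. n < length (w z) \<and> n < length (w z') \<and> w z ! n \<noteq> w z' ! n)"
    and below: "\<And>z n. n < length (w z) \<Longrightarrow>
      c (z + 1) = c z \<and> n < length (w (z + 1)) \<and> take n (w (z + 1)) = take n (w z)"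
    and k: "k < length (w (i + 1))"
    and witness_out: "\<And>z. c z \<noteq> c (i + 1) \<or>
      (\<exists>n<length (w z). n < k \<longrightarrow> w z ! n \<noteq> w (i + 1) ! n)"
    and witness_not_below: "c i \<noteq> c (i + 1) \<or>
      (\<exists>n<length (w i). n < k \<and> w i ! n \<noteq> w (i + 1) ! n)"
  shows "\<not> reversible (copies \<mu> (seq_tree r \<kappa>)) (copies_less proper_ext)"
proof -
  let ?S = "seq_tree r \<kappa>" and ?lt = "copies_less proper_ext :: _ \<Rightarrow> 'm \<times> ('a \<rightharpoonup> 'l) \<Rightarrow> bool"
  define h where "h z s = (c z, graft (w z) s)" for z s
  define x where "x = (c (i + 1), graft (take k (w (i + 1))) Map.empty)"
  have x_nth: "snd x (e n) = (if n < k then Some (w (i + 1) ! n) else None)" for n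
    using k by (simp add: x_def graft_nth graft_empty_nth)
  show ?thesis
  proof (rule not_reversible_if_cones_shift[where h = h and S = ?S and x = x and z = i and s = Map.empty])
    fix z s assume s: "s \<in> ?S"
    then show "h z s \<in> copies \<mu> ?S"
      using c graft_in_seq_tree[OF w s] by (simp add: h_def copies_def)
    fix y assume "y \<in> copies \<mu> ?S" "?lt (h z s) y"
    then show "y \<in> h z ` ?S"
      using above_graft[of "snd y" \<kappa> "w z" s]
      by (cases y) (auto simp: h_def copies_def copies_less_def proper_ext_def)
  next
    fix z z' s s' assume eq: "h z s = h z' s'"
    then have "c z = c z'" "graft (w z) s = graft (w z') s'" by (simp_all add: h_def)
    then have "z = z'" using incomparable[of z z'] graft_nth by (metis option.inject)
    then show "z = z' \<and> s = s'" using eq by (simp add: h_def)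
  next
    fix z s s' assume "?lt (h z s) (h z s')"
    then show "?lt (h (z + 1) s) (h (z + 1) s')"
      by (simp add: h_def copies_less_def proper_ext_def)
  next
    fix y z s
    assume y: "y \<in> copies \<mu> ?S" "y \<notin> (\<Union>z. h z ` ?S)" "?lt y (h z s)"
    then have yS: "fst y = c z" "snd y \<in> ?S" "snd y \<subseteq>\<^sub>m graft (w z) s"
      by (auto simp: copies_def copies_less_def h_def proper_ext_def)
    moreover have "snd y \<notin> graft (w z) ` ?S"
    proof
      assume "snd y \<in> graft (w z) ` ?S"
      then have "y \<in> h z ` ?S" using yS(1) by (cases y) (auto simp: h_def)
      then show False using y by blast
    qed
    ultimately obtain n where "n < length (w z)" "snd y = graft (take n (w z)) Map.empty"
      using below_graft by blast
    then show "?lt y (h (z + 1) s)"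
      using below[of n z] graft_take_less[of n "w (z + 1)" s] yS(1)
      by (simp add: h_def copies_less_def)
  next
    have "set (take k (w (i + 1))) \<subseteq> Field \<kappa>" using w set_take_subset by fast
    then show "x \<in> copies \<mu> ?S"
      using c graft_in_seq_tree[OF _ empty_in_seq_tree] by (simp add: x_def copies_def)
    show "x \<notin> (\<Union>z. h z ` ?S)"
    proof
      assume "x \<in> (\<Union>z. h z ` ?S)"
      then obtain z s where z: "x = h z s" by blast
      then have "c z = c (i + 1)" by (simp add: x_def h_def)
      then obtain n where n: "n < length (w z)" "n < k \<longrightarrow> w z ! n \<noteq> w (i + 1) ! n"
        using witness_out by blast
      then have "snd x (e n) = Some (w z ! n)" using z graft_nth by (simp add: h_def)
      then show False using n x_nth by (auto split: if_splits)
    qed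
    show "Map.empty \<in> ?S" by (rule empty_in_seq_tree)
    show "\<not> ?lt x (h i Map.empty)"
    proof
      assume less: "?lt x (h i Map.empty)"
      then have "c i = c (i + 1)" by (simp add: x_def h_def copies_less_def)
      then obtain n where n: "n < length (w i)" "n < k" "w i ! n \<noteq> w (i + 1) ! n"
        using witness_not_below by blast
      have "snd x (e n) = graft (w i) Map.empty (e n)"
        using less x_nth[of n] n(2)
        by (auto simp: h_def copies_less_def proper_ext_def map_le_def dom_def)
      then show False using n x_nth[of n] by (simp add: graft_nth)
    qed
    show "?lt x (h (i + 1) Map.empty)"
      using graft_take_less[OF k] by (simp add: x_def h_def copies_less_def)
  qed
qed

text \<open>
  In one copy, attach cones at \<open>v\<^sub>0\<^sup>n v\<^sub>1\<close>, to the side of the branch that is constantly \<open>v\<^sub>0\<close>, and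
  move each of them one step up along this branch.  The gap at \<open>v\<^sub>1\<close> is filled with a whole further
  copy of the tree, whose place is taken by the next copy, and so on through infinitely many copies.
  The root of the first copy becomes a node below the copy that fills the gap.
\<close>

lemma not_reversible_infinite_forest:
  assumes infinite: "infinite (Field \<mu>)" and v: "v\<^sub>0 \<in> Field \<kappa>" "v\<^sub>1 \<in> Field \<kappa>" "v\<^sub>0 \<noteq> v\<^sub>1"
  shows "\<not> reversible (copies \<mu> (seq_tree r \<kappa>)) (copies_less proper_ext)"
proof -
  obtain m :: "nat \<Rightarrow> _" where m: "inj m" "range m \<subseteq> Field \<mu>"
    using infinite_countable_subset[OF infinite] by blast
  \<comment> \<open>The negative indices are whole copies of the tree, the others hang off the branch in copy \<open>m 0\<close>.\<close>
  define c where "c z = m (nat (- z))" for z :: int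
  define w where "w z = (if z < 0 then [] else replicate (nat z) v\<^sub>0 @ [v\<^sub>1])" for z :: int
  have c_eq: "c z = c z' \<longleftrightarrow> z = z' \<or> 0 \<le> z \<and> 0 \<le> z'" for z z'
    using m(1) by (auto simp: c_def inj_eq)
  have length_w: "length (w z) = (if z < 0 then 0 else Suc (nat z))" for z
    by (simp add: w_def)
  have w_nth: "w z ! n = (if n < nat z then v\<^sub>0 else v\<^sub>1)" if "n < length (w z)" for z n
    using that by (auto simp: w_def nth_append split: if_splits)
  show ?thesis
  proof (rule not_reversible_if_addresses_shift[where c = c and w = w and i = "- 1" and k = 0])
    show "c z \<in> Field \<mu>" for z using m(2) by (auto simp: c_def)
    show "set (w z) \<subseteq> Field \<kappa>" for z using v by (auto simp: w_def)
  next
    fix z z' :: int assume neq: "z \<noteq> z'"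
    show "c z \<noteq> c z' \<or> (\<exists>n. n < length (w z) \<and> n < length (w z') \<and> w z ! n \<noteq> w z' ! n)"
    proof (cases "z < 0 \<or> z' < 0")
      case True
      then show ?thesis using neq by (auto simp: c_eq)
    next
      case False
      then have "min (nat z) (nat z') < length (w z)" "min (nat z) (nat z') < length (w z')"
        by (auto simp: length_w)
      moreover from this have "w z ! min (nat z) (nat z') \<noteq> w z' ! min (nat z) (nat z')"
        using neq v(3) False by (auto simp: w_nth min_def split: if_splits)
      ultimately show ?thesis by blast
    qed
  next
    fix z n assume n: "n < length (w z)"
    then have z: "0 \<le> z" and le: "n \<le> nat z" by (auto simp: length_w split: if_splits)
    from z have "nat (z + 1) = Suc (nat z)" by simp
    then show "c (z + 1) = c z \<and> n < length (w (z + 1)) \<and> take n (w (z + 1)) = take n (w z)"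
      using z le by (simp add: c_eq w_def min_def del: replicate_Suc)
  next
    fix z
    show "c z \<noteq> c (- 1 + 1) \<or> (\<exists>n<length (w z). n < 0 \<longrightarrow> w z ! n \<noteq> w (- 1 + 1) ! n)"
      by (auto simp: c_eq length_w)
  qed (auto simp: c_eq length_w)
qed

text \<open>
  One copy suffices if a node has infinitely many children.  The cones at \<open>v\<^sub>0 v\<^sub>n\<close> for \<open>n \<ge> 0\<close> move
  from each \<open>n\<close> to \<open>n + 1\<close>; the gap at \<open>v\<^sub>0 v\<^sub>0\<close> is filled with the cone at \<open>v\<^sub>1\<close>, whose place is taken
  by the cone at \<open>v\<^sub>2\<close>, and so on.  The node \<open>v\<^sub>0\<close> is the new node below the cone filling the gap.
\<close>

lemma not_reversible_infinite_branching:
  assumes infinite: "infinite (Field \<kappa>)" and m: "m \<in> Field \<mu>"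
  shows "\<not> reversible (copies \<mu> (seq_tree r \<kappa>)) (copies_less proper_ext)"
proof -
  obtain v :: "nat \<Rightarrow> _" where v: "inj v" "range v \<subseteq> Field \<kappa>"
    using infinite_countable_subset[OF infinite] by blast
  show ?thesis
  proof (rule not_reversible_if_addresses_shift[where c = "\<lambda>_. m"
        and w = "\<lambda>z. if z < 0 then [v (nat (- z))] else [v 0, v (nat z)]" and i = "- 1" and k = 1])
    fix z z' :: int assume neq: "z \<noteq> z'"
    show "m \<noteq> m \<or> (\<exists>n. n < length (if z < 0 then [v (nat (- z))] else [v 0, v (nat z)]) \<and>
        n < length (if z' < 0 then [v (nat (- z'))] else [v 0, v (nat z')]) \<and>
        (if z < 0 then [v (nat (- z))] else [v 0, v (nat z)]) ! n \<noteq>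
        (if z' < 0 then [v (nat (- z'))] else [v 0, v (nat z')]) ! n)"
      using neq v(1)
      by (intro disjI2 exI[of _ "if z < 0 \<or> z' < 0 then 0 else 1"]) (auto simp: inj_eq)
  qed (use m v in \<open>auto simp: inj_eq less_Suc_eq\<close>)
qed

end

section \<open>Siblings in a forest of sequences\<close>

definition seq_length :: "'a rel \<Rightarrow> ('a \<rightharpoonup> 'l) \<Rightarrow> 'a" where
  "seq_length \<alpha> s = (THE b. b \<in> Field \<alpha> \<and> dom s = underS \<alpha> b)"

locale sequence_forest =
  fixes \<alpha> :: "'a rel" and \<kappa> :: "'l rel" and \<mu> :: "'m rel"
  assumes well_order: "Well_order \<alpha>"
begin

lemma underS_mono: "a \<in> underS \<alpha> b \<Longrightarrow> underS \<alpha> a \<subseteq> underS \<alpha> b"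
  using well_order unfolding underS_def order_on_defs
  by (auto dest: transD antisymD)

lemma underS_irrefl: "a \<notin> underS \<alpha> a"
  by (simp add: underS_def)

lemma underS_in_Field: "a \<in> underS \<alpha> b \<Longrightarrow> a \<in> Field \<alpha>"
  by (auto simp: underS_def Field_def)

lemma seq_length_eq:
  assumes "b \<in> Field \<alpha>" "dom s = underS \<alpha> b"
  shows "seq_length \<alpha> s = b"
  unfolding seq_length_def
proof (rule the_equality)
  fix b' assume "b' \<in> Field \<alpha> \<and> dom s = underS \<alpha> b'"
  then show "b' = b" using assms underS_linear[OF well_order, of b b'] underS_irrefl by metis
qed (use assms in simp)

lemma seq_length:
  assumes "s \<in> seq_tree \<alpha> \<kappa>"
  shows "seq_length \<alpha> s \<in> Field \<alpha>" "dom s = underS \<alpha> (seq_length \<alpha> s)" "ran s \<subseteq> Field \<kappa>"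
proof -
  obtain b where b: "b \<in> Field \<alpha>" "dom s = underS \<alpha> b" "ran s \<subseteq> Field \<kappa>"
    using assms unfolding seq_tree_def sequences_def by auto
  then show "seq_length \<alpha> s \<in> Field \<alpha>" "dom s = underS \<alpha> (seq_length \<alpha> s)" "ran s \<subseteq> Field \<kappa>"
    by (simp_all add: seq_length_eq)
qed

lemma in_seq_treeI:
  "b \<in> Field \<alpha> \<Longrightarrow> dom s = underS \<alpha> b \<Longrightarrow> ran s \<subseteq> Field \<kappa> \<Longrightarrow> s \<in> seq_tree \<alpha> \<kappa>"
  unfolding seq_tree_def sequences_def by auto

lemma proper_ext_length:
  assumes "s \<in> seq_tree \<alpha> \<kappa>" "t \<in> seq_tree \<alpha> \<kappa>" "proper_ext s t"
  shows "seq_length \<alpha> s \<in> underS \<alpha> (seq_length \<alpha> t)"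
proof -
  have le: "s \<subseteq>\<^sub>m t" "s \<noteq> t" using assms unfolding proper_ext_def by auto
  then have dom: "dom s \<subseteq> dom t" by (simp add: map_le_implies_dom_le)
  moreover have "dom s \<noteq> dom t"
    using le unfolding map_le_def by (metis domIff ext)
  ultimately show ?thesis
    using underS_linear[OF well_order, of "seq_length \<alpha> s" "seq_length \<alpha> t"] seq_length assms
      underS_mono[of "seq_length \<alpha> t" "seq_length \<alpha> s"] by (metis subset_antisym)
qed

lemma restrict:
  assumes s: "s \<in> seq_tree \<alpha> \<kappa>" and b: "b \<in> underS \<alpha> (seq_length \<alpha> s)"
  shows "s |` underS \<alpha> b \<in> seq_tree \<alpha> \<kappa>" "seq_length \<alpha> (s |` underS \<alpha> b) = b"
    "proper_ext (s |` underS \<alpha> b) s"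
proof -
  have dom: "dom (s |` underS \<alpha> b) = underS \<alpha> b"
    using seq_length(2)[OF s] underS_mono[OF b] by auto
  moreover have "ran (s |` underS \<alpha> b) \<subseteq> Field \<kappa>"
    using seq_length(3)[OF s] by (auto simp: ran_def restrict_map_def split: if_splits)
  ultimately show "s |` underS \<alpha> b \<in> seq_tree \<alpha> \<kappa>" "seq_length \<alpha> (s |` underS \<alpha> b) = b"
    using in_seq_treeI seq_length_eq underS_in_Field[OF b] by blast+
  have "b \<in> dom s" using b seq_length(2)[OF s] by simp
  then have "s |` underS \<alpha> b \<noteq> s" using dom underS_irrefl by metis
  then show "proper_ext (s |` underS \<alpha> b) s"
    unfolding proper_ext_def by (auto simp: map_le_def)
qed

lemma proper_ext_restrict:
  assumes "s \<in> seq_tree \<alpha> \<kappa>" "proper_ext s t"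
  shows "s = t |` underS \<alpha> (seq_length \<alpha> s)"
proof
  fix a
  show "s a = (t |` underS \<alpha> (seq_length \<alpha> s)) a"
    using assms(2) seq_length(2)[OF assms(1)] unfolding proper_ext_def map_le_def
    by (cases "a \<in> dom s") (auto simp: restrict_map_def domIff)
qed

abbreviation "forest \<equiv> copies \<mu> (seq_tree \<alpha> \<kappa>)"

sublocale levelled_tree forest "copies_less proper_ext" \<alpha> "\<lambda>p. seq_length \<alpha> (snd p)"
proof
  show "Well_order \<alpha>" by (rule well_order)
next
  fix x assume "x \<in> forest"
  then show "seq_length \<alpha> (snd x) \<in> Field \<alpha>" using seq_length by (auto simp: copies_def)
next
  fix x y assume "x \<in> forest" "y \<in> forest" "copies_less proper_ext x y"
  then show "seq_length \<alpha> (snd x) \<in> underS \<alpha> (seq_length \<alpha> (snd y))"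
    using proper_ext_length by (auto simp: copies_def copies_less_def)
next
  fix y b assume y: "y \<in> forest" and b: "b \<in> underS \<alpha> (seq_length \<alpha> (snd y))"
  then show "\<exists>x\<in>forest. copies_less proper_ext x y \<and> seq_length \<alpha> (snd x) = b"
    using restrict[of "snd y" b]
    by (intro bexI[of _ "(fst y, snd y |` underS \<alpha> b)"]) (auto simp: copies_def copies_less_def)
next
  fix x x' y
  assume "x \<in> forest" "x' \<in> forest" "y \<in> forest" "copies_less proper_ext x y"
    "copies_less proper_ext x' y" "seq_length \<alpha> (snd x) = seq_length \<alpha> (snd x')"
  then show "x = x'"
    using proper_ext_restrict[of "snd x" "snd y"] proper_ext_restrict[of "snd x'" "snd y"]
    by (auto simp: copies_def copies_less_def prod_eq_iff)
next
  fix x y z :: "'m \<times> ('a \<rightharpoonup> 'l)"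
  assume "copies_less proper_ext x y" "copies_less proper_ext y z"
  then show "copies_less proper_ext x z"
    unfolding copies_less_def proper_ext_def by (auto intro: map_le_trans dest: map_le_antisym)
qed

text \<open>
  Sequences can be prolonged to any admissible length by a constant, so the forest is pruned.
\<close>

lemma reversible_if_finite_length:
  assumes "finite (Field \<alpha>)" and v: "v \<in> Field \<kappa>"
  shows "reversible forest (copies_less proper_ext)"
proof (rule reversible_if_finite_height)
  fix x b assume x: "x \<in> forest" and b: "b \<in> Field \<alpha>" "seq_length \<alpha> (snd x) \<in> underS \<alpha> b"
  define t where "t a = (if a \<in> underS \<alpha> b then Some (case snd x a of Some u \<Rightarrow> u | None \<Rightarrow> v) else None)" for a
  have s: "snd x \<in> seq_tree \<alpha> \<kappa>" using x by (auto simp: copies_def)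
  have dom_s: "dom (snd x) \<subseteq> underS \<alpha> b" using seq_length(2)[OF s] underS_mono[OF b(2)] by simp
  have dom_t: "dom t = underS \<alpha> b" by (auto simp: t_def split: if_splits)
  have "ran t \<subseteq> Field \<kappa>"
    using v seq_length(3)[OF s] by (auto simp: t_def ran_def split: if_splits option.splits)
  then have t: "t \<in> seq_tree \<alpha> \<kappa>" using in_seq_treeI b dom_t by blast
  have "snd x \<subseteq>\<^sub>m t"
    unfolding map_le_def
  proof
    fix a assume "a \<in> dom (snd x)"
    then show "snd x a = t a" using dom_s by (auto simp: t_def)
  qed
  moreover have "snd x \<noteq> t"
    using seq_length_eq[OF b(1) dom_t] b(2) underS_irrefl by metis
  ultimately show "\<exists>y\<in>forest. copies_less proper_ext x y \<and> seq_length \<alpha> (snd y) = b"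
    using t x seq_length_eq[OF b(1) dom_t]
    by (intro bexI[of _ "(fst x, t)"]) (auto simp: copies_def copies_less_def proper_ext_def)
qed fact

lemma siblings_in:
  assumes "y \<in> siblings x"
  shows "fst y \<in> Field \<mu>" "snd y \<in> seq_tree \<alpha> \<kappa>" "seq_length \<alpha> (snd y) = seq_length \<alpha> (snd x)"
proof -
  have "y \<in> forest" "seq_length \<alpha> (snd y) = seq_length \<alpha> (snd x)"
    using assms unfolding siblings_def by simp_all
  then show "fst y \<in> Field \<mu>" "snd y \<in> seq_tree \<alpha> \<kappa>"
    "seq_length \<alpha> (snd y) = seq_length \<alpha> (snd x)" by (auto simp: copies_def)
qed

text \<open>
  A sibling \<open>y\<close> of \<open>x\<close> extends every proper restriction of \<open>x\<close>, so it agrees with \<open>x\<close> at each position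
  that has a later position in the domain.  Hence only a last position leaves any freedom.
\<close>

lemma siblings_agree:
  assumes x: "x \<in> forest" and y: "y \<in> siblings x"
    and a: "a \<in> underS \<alpha> (seq_length \<alpha> (snd x))"
  shows "fst y = fst x" "c \<in> underS \<alpha> a \<Longrightarrow> snd y c = snd x c"
proof -
  let ?z = "(fst x, snd x |` underS \<alpha> a)"
  have s: "snd x \<in> seq_tree \<alpha> \<kappa>" using x by (auto simp: copies_def)
  have "?z \<in> forest" "copies_less proper_ext ?z x"
    using restrict[OF s a] x by (auto simp: copies_def copies_less_def)
  then have z: "copies_less proper_ext ?z y" using y unfolding siblings_def by blast
  then show "fst y = fst x" by (simp add: copies_less_def)
  assume c: "c \<in> underS \<alpha> a"
  then have "c \<in> dom (snd x)" using seq_length(2)[OF s] underS_mono[OF a] by blast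
  then have "c \<in> dom (snd x |` underS \<alpha> a)" using c by simp
  then show "snd y c = snd x c"
    using z c by (auto simp: copies_less_def proper_ext_def map_le_def)
qed

lemma siblings_root:
  assumes x: "x \<in> forest" and root: "underS \<alpha> (seq_length \<alpha> (snd x)) = {}"
  shows "siblings x = Field \<mu> \<times> {Map.empty}"
proof -
  have s: "snd x \<in> seq_tree \<alpha> \<kappa>" using x by (auto simp: copies_def)
  have empty: "t = Map.empty"
    if "t \<in> seq_tree \<alpha> \<kappa>" "seq_length \<alpha> t = seq_length \<alpha> (snd x)" for t
    using seq_length(2)[OF that(1)] that(2) root by simp
  have minimal: "\<not> copies_less proper_ext z (m, Map.empty)"
    for m and z :: "'m \<times> ('a \<rightharpoonup> 'l)"
    by (auto simp: copies_less_def proper_ext_def map_le_def dom_def)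
  show ?thesis
  proof (intro equalityI subsetI)
    fix y assume "y \<in> siblings x"
    then show "y \<in> Field \<mu> \<times> {Map.empty}"
      using empty[of "snd y"] siblings_in[of y x] by (simp add: mem_Times_iff)
  next
    fix y :: "'m \<times> ('a \<rightharpoonup> 'l)" assume "y \<in> Field \<mu> \<times> {Map.empty}"
    then obtain m where y: "m \<in> Field \<mu>" "y = (m, Map.empty)" by blast
    have "x = (fst x, Map.empty)" using empty[OF s refl] by (simp add: prod_eq_iff)
    then have "\<not> copies_less proper_ext z x" for z using minimal by metis
    then show "y \<in> siblings x"
      unfolding siblings_def using y minimal s empty[OF s refl] by (simp add: copies_def)
  qed
qed

lemma siblings_successor:
  assumes x: "x \<in> forest" and c: "c \<in> underS \<alpha> (seq_length \<alpha> (snd x))"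
    and last: "\<And>a. a \<in> underS \<alpha> (seq_length \<alpha> (snd x)) \<Longrightarrow> c \<notin> underS \<alpha> a"
  shows "siblings x = (\<lambda>v. (fst x, (snd x)(c \<mapsto> v))) ` Field \<kappa>"
proof (intro equalityI subsetI)
  let ?b = "seq_length \<alpha> (snd x)"
  have s: "snd x \<in> seq_tree \<alpha> \<kappa>" using x by (auto simp: copies_def)
  note len = seq_length[OF s]
  {
    fix y assume y: "y \<in> siblings x"
    then have t: "snd y \<in> seq_tree \<alpha> \<kappa>" "seq_length \<alpha> (snd y) = ?b"
      using siblings_in by blast+
    then have dom: "dom (snd y) = underS \<alpha> ?b" using seq_length(2) by metis
    then obtain v where v: "snd y c = Some v" using c by blast
    then have "v \<in> Field \<kappa>" using seq_length(3)[OF t(1)] by (auto simp: ran_def)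
    moreover have "snd y = (snd x)(c \<mapsto> v)"
    proof
      fix a
      consider "a = c" | "a \<noteq> c" "a \<in> underS \<alpha> ?b" | "a \<notin> underS \<alpha> ?b" by blast
      then show "snd y a = ((snd x)(c \<mapsto> v)) a"
      proof cases
        case 2
        then have "a \<in> underS \<alpha> c"
          using underS_linear[OF well_order, of a c] last underS_in_Field c by blast
        then show ?thesis using siblings_agree(2)[OF x y c] 2 by simp
      next
        case 3
        then show ?thesis using dom len(2) c by (metis domIff fun_upd_other)
      qed (use v in simp)
    qed
    ultimately show "y \<in> (\<lambda>v. (fst x, (snd x)(c \<mapsto> v))) ` Field \<kappa>"
      using siblings_agree(1)[OF x y c] by (metis image_eqI prod.collapse)
  next
    fix y assume "y \<in> (\<lambda>v. (fst x, (snd x)(c \<mapsto> v))) ` Field \<kappa>"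
    then obtain v where v: "v \<in> Field \<kappa>" "y = (fst x, (snd x)(c \<mapsto> v))" by blast
    have dom: "dom (snd y) = underS \<alpha> ?b" using v len(2) c by auto
    moreover have "ran (snd y) \<subseteq> Field \<kappa>"
      using v len(3) by (auto simp: ran_def split: if_splits)
    ultimately have t: "snd y \<in> seq_tree \<alpha> \<kappa>" "seq_length \<alpha> (snd y) = ?b"
      using in_seq_treeI seq_length_eq len(1) by blast+
    \<comment> \<open>A proper restriction cannot contain the last position \<open>c\<close>, so changing the entry at \<open>c\<close>
      has no effect on which sequences are below.\<close>
    have transfer: "proper_ext u t'"
      if u: "u \<in> seq_tree \<alpha> \<kappa>" "proper_ext u t" and t: "t \<in> seq_tree \<alpha> \<kappa>" "seq_length \<alpha> t = ?b"
        and t': "dom t' = underS \<alpha> ?b" "\<And>a. a \<noteq> c \<Longrightarrow> t' a = t a" for u t t' :: "'a \<rightharpoonup> 'l"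
    proof -
      have "seq_length \<alpha> u \<in> underS \<alpha> ?b" using proper_ext_length u t by metis
      then have "c \<notin> dom u" using last seq_length(2)[OF u(1)] by simp
      moreover from this have "u \<noteq> t'" using c t'(1) by metis
      ultimately show ?thesis using u(2) t'(2) unfolding proper_ext_def map_le_def by metis
    qed
    have "copies_less proper_ext z y \<longleftrightarrow> copies_less proper_ext z x" if "z \<in> forest" for z
      using that transfer[of "snd z" "snd x" "snd y"] transfer[of "snd z" "snd y" "snd x"] s t dom len(2) v
      by (auto simp: copies_less_def copies_def)
    moreover have "y \<in> forest" using t x v by (auto simp: copies_def)
    ultimately show "y \<in> siblings x" using t unfolding siblings_def by blast
  }
qed

lemma siblings_limit:
  assumes x: "x \<in> forest" and nonempty: "underS \<alpha> (seq_length \<alpha> (snd x)) \<noteq> {}"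
    and limit: "\<And>c. c \<in> underS \<alpha> (seq_length \<alpha> (snd x)) \<Longrightarrow>
      \<exists>a\<in>underS \<alpha> (seq_length \<alpha> (snd x)). c \<in> underS \<alpha> a"
  shows "siblings x = {x}"
proof (intro equalityI subsetI)
  fix y assume y: "y \<in> siblings x"
  have s: "snd x \<in> seq_tree \<alpha> \<kappa>" using x by (auto simp: copies_def)
  have t: "snd y \<in> seq_tree \<alpha> \<kappa>" "seq_length \<alpha> (snd y) = seq_length \<alpha> (snd x)"
    using siblings_in[OF y] by blast+
  have "snd y c = snd x c" for c
  proof (cases "c \<in> underS \<alpha> (seq_length \<alpha> (snd x))")
    case True
    then show ?thesis using limit siblings_agree(2)[OF x y] by blast
  next
    case False
    then show ?thesis using seq_length(2)[OF s] seq_length(2)[OF t(1)] t(2) by (metis domIff)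
  qed
  moreover have "fst y = fst x" using nonempty siblings_agree(1)[OF x y] by blast
  ultimately show "y \<in> {x}" by (auto simp: prod_eq_iff)
qed (use x in \<open>auto simp: siblings_def\<close>)

text \<open>
  How many siblings a node has depends only on the kind of ordinal its length is: \<open>\<mu>\<close> for length zero,
  \<open>\<kappa>\<close> for a successor, and one for a limit.
\<close>

lemma siblings_uniform:
  assumes \<kappa>: "finite (Field \<kappa>)" and \<mu>: "finite (Field \<mu>)"
  shows "\<exists>n. \<forall>x\<in>forest. seq_length \<alpha> (snd x) = b \<longrightarrow> finite (siblings x) \<and> card (siblings x) = n"
proof -
  consider "underS \<alpha> b = {}"
    | c where "c \<in> underS \<alpha> b" "\<And>a. a \<in> underS \<alpha> b \<Longrightarrow> c \<notin> underS \<alpha> a"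
    | "underS \<alpha> b \<noteq> {}" "\<And>c. c \<in> underS \<alpha> b \<Longrightarrow> \<exists>a\<in>underS \<alpha> b. c \<in> underS \<alpha> a"
    by blast
  then show ?thesis
  proof cases
    case 1
    then show ?thesis
      using siblings_root \<mu> by (intro exI[of _ "card (Field \<mu>)"]) (auto simp: card_cartesian_product)
  next
    case 2
    have "inj_on (\<lambda>v. (fst x, (snd x)(c \<mapsto> v))) (Field \<kappa>)" for x :: "'m \<times> ('a \<rightharpoonup> 'l)"
      by (auto intro!: inj_onI dest: map_upd_eqD1)
    then show ?thesis
      using siblings_successor 2 \<kappa> by (intro exI[of _ "card (Field \<kappa>)"]) (auto simp: card_image)
  next
    case 3
    then have "siblings x = {x}" if "x \<in> forest" "seq_length \<alpha> (snd x) = b" for x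
      using siblings_limit that by blast
    then show ?thesis by (intro exI[of _ 1]) simp
  qed
qed

lemma reversible_if_finitely_branching:
  assumes "finite (Field \<kappa>)" "finite (Field \<mu>)"
  shows "reversible forest (copies_less proper_ext)"
  using siblings_uniform[OF assms] by (intro reversible_if_finite_siblings) metis+

end

section \<open>Finite ordinals and the main result\<close>

lemma less_natLeq_iff_finite:
  assumes "Well_order r"
  shows "r <o natLeq \<longleftrightarrow> finite (Field r)"
proof
  assume "r <o natLeq"
  then have "|Field r| <o natLeq" using card_of_least[OF assms] ordLeq_ordLess_trans by blast
  then show "finite (Field r)" by (simp add: finite_iff_ordLess_natLeq)
next
  assume "finite (Field r)"
  then show "r <o natLeq"
    by (intro finite_ordLess_infinite[OF assms natLeq_Well_order]) (simp_all add: Field_natLeq)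
qed

lemma ord_min_less_natLeq_iff:
  assumes r: "Well_order r" and s: "Well_order s"
  shows "ord_min r s <o natLeq \<longleftrightarrow> finite (Field r) \<or> finite (Field s)"
proof -
  have copy: "dir_image t f <o natLeq \<longleftrightarrow> finite (Field t)" if "Well_order t" "inj f"
    for t :: "'x rel" and f :: "'x \<Rightarrow> 'y"
  proof -
    have inj: "inj_on f (Field t)" using that(2) by (rule inj_on_subset) simp
    then show ?thesis
      using less_natLeq_iff_finite[OF Well_order_dir_image[OF that(1) inj]]
      by (simp add: dir_image_Field finite_image_iff[OF inj])
  qed
  show ?thesis
  proof (cases "r \<le>o s")
    case True
    have "finite (Field r)" if "finite (Field s)"
      using that ordLeq_ordLess_trans[OF True, of natLeq] less_natLeq_iff_finite[OF r] less_natLeq_iff_finite[OF s]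
      by simp
    then show ?thesis using copy[OF r inj_Inl] True by (auto simp: ord_min_def)
  next
    case False
    then have le: "s \<le>o r" using ordLeq_total[OF r s] by blast
    have "finite (Field s)" if "finite (Field r)"
      using that ordLeq_ordLess_trans[OF le, of natLeq] less_natLeq_iff_finite[OF r] less_natLeq_iff_finite[OF s]
      by simp
    then show ?thesis using copy[OF s inj_Inr] False by (auto simp: ord_min_def)
  qed
qed

lemma omega_embedding_exists:
  assumes \<alpha>: "Well_order \<alpha>" and infinite: "infinite (Field \<alpha>)"
  shows "\<exists>e. omega_embedding \<alpha> e"
proof -
  have "natLeq \<le>o \<alpha>"
    using not_ordLess_iff_ordLeq[OF natLeq_Well_order \<alpha>] less_natLeq_iff_finite[OF \<alpha>] infinite by simp
  then obtain e where e: "embed natLeq \<alpha> e" unfolding ordLeq_def by blast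
  have "underS natLeq n = {..<n}" for n by (auto simp: underS_def natLeq_def)
  then have "omega_embedding \<alpha> e"
    using \<alpha> embed_in_Field[OF e] embed_inj_on[OF natLeq_Well_order e]
      embed_underS[OF natLeq_Well_order e]
    by unfold_locales (auto simp: Field_natLeq bij_betw_def)
  then show ?thesis by blast
qed

theorem theorem6p2:
  fixes \<kappa> :: "'l rel" and \<mu> :: "'m rel" and \<alpha> :: "'a rel"
  assumes "Card_order \<kappa>" and "ctwo \<le>o \<kappa>"
    and "Card_order \<mu>" and "(czero :: 'm rel) <o \<mu>"
    and "Well_order \<alpha>" and "(czero :: 'a rel) <o \<alpha>"
  shows "reversible (copies \<mu> (seq_tree \<alpha> \<kappa>)) (copies_less proper_ext)
    \<longleftrightarrow> ord_min \<alpha> (\<kappa> *c \<mu>) <o natLeq"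
proof -
  obtain g :: "bool \<Rightarrow> 'l" where g: "embed |UNIV :: bool set| \<kappa> g"
    using assms(2) unfolding ctwo_def ordLeq_def by blast
  then have "inj g" "range g \<subseteq> Field \<kappa>"
    using embed_inj_on[OF card_of_Well_order g] embed_Field[OF g] by (simp_all add: Field_card_of)
  then have v: "g False \<in> Field \<kappa>" "g True \<in> Field \<kappa>" "g False \<noteq> g True"
    by (auto simp: inj_eq)
  have "Field \<mu> \<noteq> {}"
  proof
    have empty: "R = {}" if "Field R = {}" for R :: "'m rel" using that by (auto simp: Field_def)
    assume "Field \<mu> = {}"
    then have "\<mu> = (czero :: 'm rel)" using empty[of \<mu>] empty[of czero] by (simp add: czero_def Field_card_of)
    then show False using assms(4) ordLess_irreflexive by metis
  qed
  then obtain m where m: "m \<in> Field \<mu>" by blast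
  have "finite (Field (\<kappa> *c \<mu>)) \<longleftrightarrow> finite (Field \<kappa>) \<and> finite (Field \<mu>)"
    using v m by (auto simp: cprod_def Field_card_of finite_cartesian_product_iff)
  then have min: "ord_min \<alpha> (\<kappa> *c \<mu>) <o natLeq \<longleftrightarrow>
      finite (Field \<alpha>) \<or> finite (Field \<kappa>) \<and> finite (Field \<mu>)"
    using ord_min_less_natLeq_iff[OF assms(5)] card_of_Well_order unfolding cprod_def by blast
  interpret sequence_forest \<alpha> \<kappa> \<mu> by unfold_locales fact
  show ?thesis
  proof (cases "finite (Field \<alpha>)")
    case True
    then show ?thesis using min reversible_if_finite_length v by blast
  next
    case False
    then obtain e where "omega_embedding \<alpha> e" using omega_embedding_exists assms(5) by blast
    then interpret omega_embedding \<alpha> e .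
    show ?thesis
      using min False reversible_if_finitely_branching not_reversible_infinite_forest[OF _ v]
        not_reversible_infinite_branching[OF _ m] by blast
  qed
qed

end
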